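(* Let $\mathcal{A}$ be a unital $C^*$-algebra, $\mathcal{N}$ a Hilbert $C^*$-module over $\mathcal{A}$, and $Z$ a bounded subset of $\mathcal{N}$. If for every $\varepsilon>0$ there exists a free finitely generated submodule $L_s\subset\mathcal{N}$ such that $\operatorname{dist}(Z,L_s)<\varepsilon$, then $Z$ is $\mathcal{A}$-precompact. If, in addition, $\mathcal{N}=\ell_2^J(\mathcal{A})$ for some index set $J$, then the converse is also true: if $Z$ is $\mathcal{A}$-precompact, then for every $\varepsilon>0$ there exists a free finitely generated submodule $L_s\subset\mathcal{N}$ such that $\operatorname{dist}(Z,L_s)<\varepsilon$.
   Context: Hilbert $C^*$-modules are right Hilbert modules with $\langle x,ya\rangle=\langle x,y\rangle a$. $\operatorname{dist}(Z,L)<\varepsilon$ means that $\operatorname{dist}(x,L)<\varepsilon$ (norm distance) for every $x\in Z$. A submodule $L\subset\mathcal{N}$ is free (finitely generated) if $L\cong\mathcal{A}^n$ for some $n\in\mathbb{N}$; for unital $\mathcal{A}$ this means that there exist $e_1,\dots,e_n\in L$ with $\langle e_i,e_j\rangle=\delta_{i,j}1_{\mathcal{A}}$ and $L=\operatorname{Span}_{\mathcal{A}}(e_1,\dots,e_n)$. $\ell_2^J(\mathcal{A})=\bigoplus_{j\in J}\mathcal{A}$ is the Hilbert direct sum of copies of $\mathcal{A}$, where $\mathcal{A}$ has inner product $\langle a,b\rangle=a^*b$. A bounded subset $Z\subset\mathcal{N}$ is $\mathcal{A}$-precompact if for every $\varepsilon>0$ there exist $M_\varepsilon>0$ and $z_1,\dots,z_s\in\mathcal{N}$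 such that for every $x\in Z$ there exist $a_1,\dots,a_s\in\mathcal{A}$ with $\|a_k\|\le M_\varepsilon$ and $\|x-\sum_{k=1}^sz_ka_k\|<\varepsilon$. *)

theory Defs
  imports "HOL-Analysis.Analysis" "HOL-Library.Function_Algebras"
begin

text \<open>
  The class extends \<^class>\<open>monoid_mult\<close> instead of \<^class>\<open>ring_1\<close> because the latter demands
  \<open>0 \<noteq> 1\<close>, which would exclude the zero algebra.
\<close>

class unital_cstar_algebra = real_normed_algebra + banach + monoid_mult +
  fixes scaleC :: "complex \<Rightarrow> 'a \<Rightarrow> 'a"  (infixr "*\<^sub>C" 75)
    and star :: "'a \<Rightarrow> 'a"
  assumes scaleC_add_right: "c *\<^sub>C (a + b) = c *\<^sub>C a + c *\<^sub>C b"
    and scaleC_add_left: "(c + d) *\<^sub>C a = c *\<^sub>C a + d *\<^sub>C a"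
    and scaleC_scaleC: "c *\<^sub>C d *\<^sub>C a = (c * d) *\<^sub>C a"
    and scaleR_scaleC: "r *\<^sub>R a = complex_of_real r *\<^sub>C a"
    and mult_scaleC_left: "(c *\<^sub>C a) * b = c *\<^sub>C (a * b)"
    and mult_scaleC_right: "a * (c *\<^sub>C b) = c *\<^sub>C (a * b)"
    and norm_scaleC: "norm (c *\<^sub>C a) = cmod c * norm a"
    and star_add: "star (a + b) = star a + star b"
    and star_scaleC: "star (c *\<^sub>C a) = cnj c *\<^sub>C star a"
    and star_mult: "star (a * b) = star b * star a"
    and star_star: "star (star a) = a"
    and cstar_identity: "norm (star a * a) = (norm a)\<^sup>2"

definition cstar_spectrum :: "'a::unital_cstar_algebra \<Rightarrow> complex set" where
  "cstar_spectrum a = {c. \<not> (\<exists>b. (c *\<^sub>C 1 - a) * b = 1 \<and> b * (c *\<^sub>C 1 - a) = 1)}"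

definition cstar_positive :: "'a::unital_cstar_algebra \<Rightarrow> bool" where
  "cstar_positive a \<longleftrightarrow> star a = a \<and> cstar_spectrum a \<subseteq> complex_of_real ` {0..}"

text \<open>
  A module is given by a subset of an ambient abelian group, from which it inherits addition,
  together with a right action and an algebra-valued form.  There is no separate complex scalar
  multiplication: over a unital algebra it has to be \<open>c x = x (c 1)\<close>.
\<close>

record ('a, 'n) inner_module =
  mcarrier :: "'n set"
  mact :: "'n \<Rightarrow> 'a \<Rightarrow> 'n"
  minner :: "'n \<Rightarrow> 'n \<Rightarrow> 'a"

definition mnorm :: "('a::unital_cstar_algebra, 'n) inner_module \<Rightarrow> 'n \<Rightarrow> real" where
  "mnorm N x = sqrt (norm (minner N x x))"

locale hilbert_module =
  fixes N :: "('a::unital_cstar_algebra, 'n::ab_group_add) inner_module"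
  assumes zero_mem: "0 \<in> mcarrier N"
    and add_mem: "x \<in> mcarrier N \<Longrightarrow> y \<in> mcarrier N \<Longrightarrow> x + y \<in> mcarrier N"
    and uminus_mem: "x \<in> mcarrier N \<Longrightarrow> - x \<in> mcarrier N"
    and act_mem: "x \<in> mcarrier N \<Longrightarrow> mact N x a \<in> mcarrier N"
    and act_add_left: "x \<in> mcarrier N \<Longrightarrow> y \<in> mcarrier N \<Longrightarrow>
          mact N (x + y) a = mact N x a + mact N y a"
    and act_add_right: "x \<in> mcarrier N \<Longrightarrow> mact N x (a + b) = mact N x a + mact N x b"
    and act_mult: "x \<in> mcarrier N \<Longrightarrow> mact N x (a * b) = mact N (mact N x a) b"
    and act_one: "x \<in> mcarrier N \<Longrightarrow> mact N x 1 = x"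
    and inner_add_right: "x \<in> mcarrier N \<Longrightarrow> y \<in> mcarrier N \<Longrightarrow> z \<in> mcarrier N \<Longrightarrow>
          minner N x (y + z) = minner N x y + minner N x z"
    and inner_act_right: "x \<in> mcarrier N \<Longrightarrow> y \<in> mcarrier N \<Longrightarrow>
          minner N x (mact N y a) = minner N x y * a"
    and inner_star: "x \<in> mcarrier N \<Longrightarrow> y \<in> mcarrier N \<Longrightarrow> star (minner N x y) = minner N y x"
    and inner_positive: "x \<in> mcarrier N \<Longrightarrow> cstar_positive (minner N x x)"
    and inner_definite: "x \<in> mcarrier N \<Longrightarrow> minner N x x = 0 \<Longrightarrow> x = 0"
    and complete: "(\<And>n. s n \<in> mcarrier N) \<Longrightarrow>
          (\<And>e::real. e > 0 \<Longrightarrow> \<exists>K::nat. \<forall>m\<ge>K. \<forall>n\<ge>K. mnorm N (s m - s n) < e) \<Longrightarrow>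
          \<exists>x\<in>mcarrier N. (\<lambda>n. mnorm N (s n - x)) \<longlonglongrightarrow> 0"

text \<open>
  The vectors of \<open>ell2 J\<close> are families indexed by \<open>J\<close>, encoded as functions that vanish outside
  \<open>J\<close>.  Summability is norm convergence of the net of finite partial sums.
\<close>

definition ell2 :: "'j set \<Rightarrow> ('a::unital_cstar_algebra, 'j \<Rightarrow> 'a) inner_module" where
  "ell2 J =
    \<lparr> mcarrier = {x. (\<forall>j. j \<notin> J \<longrightarrow> x j = 0) \<and> (\<lambda>j. star (x j) * x j) summable_on J},
      mact = (\<lambda>x a j. x j * a),
      minner = (\<lambda>x y. \<Sum>\<^sub>\<infinity>j\<in>J. star (x j) * y j) \<rparr>"

definition mbounded :: "('a::unital_cstar_algebra, 'n) inner_module \<Rightarrow> 'n set \<Rightarrow> bool" where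
  "mbounded N Z \<longleftrightarrow> (\<exists>C. \<forall>x\<in>Z. mnorm N x \<le> C)"

definition module_dist :: "('a::unital_cstar_algebra, 'n::ab_group_add) inner_module \<Rightarrow>
    'n \<Rightarrow> 'n set \<Rightarrow> real" where
  "module_dist N x L = (INF y\<in>L. mnorm N (x - y))"

text \<open>The rank \<open>n = 0\<close>, i.e. \<open>L = {0}\<close>, is allowed.\<close>

definition free_fg_submodule :: "('a::unital_cstar_algebra, 'n::ab_group_add) inner_module \<Rightarrow>
    'n set \<Rightarrow> bool" where
  "free_fg_submodule N L \<longleftrightarrow>
    L \<subseteq> mcarrier N \<and>
    (\<exists>(n::nat) e. (\<forall>i<n. e i \<in> L) \<and>
       (\<forall>i<n. \<forall>j<n. minner N (e i) (e j) = (if i = j then 1 else 0)) \<and>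
       L = range (\<lambda>a. \<Sum>i<n. mact N (e i) (a i)))"

definition A_precompact :: "('a::unital_cstar_algebra, 'n::ab_group_add) inner_module \<Rightarrow>
    'n set \<Rightarrow> bool" where
  "A_precompact N Z \<longleftrightarrow>
    Z \<subseteq> mcarrier N \<and> mbounded N Z \<and>
    (\<forall>\<epsilon>>0. \<exists>M>0. \<exists>(s::nat) z. (\<forall>k<s. z k \<in> mcarrier N) \<and>
       (\<forall>x\<in>Z. \<exists>a. (\<forall>k<s. norm (a k) \<le> M) \<and>
          mnorm N (x - (\<Sum>k<s. mact N (z k) (a k))) < \<epsilon>))"

end

theory Submission
  imports Defs
begin

text \<open>
  If \<open>Z\<close> is close to a free submodule with orthonormal basis \<open>e\<^sub>1, \<dots>, e\<^sub>n\<close>, then its elements are close to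
  combinations of the \<open>e\<^sub>k\<close> whose coefficients \<open>\<langle>e\<^sub>k, y\<rangle>\<close> are bounded by the Cauchy-Schwarz inequality
  (lemma \<open>A_precompact_if_near_free\<close>).  Conversely, in the standard module a finite system
  \<open>z\<^sub>1, \<dots>, z\<^sub>s\<close> is approximated by vectors supported in a finite set \<open>F\<close> of coordinates, and the vectors
  supported in \<open>F\<close> form a free submodule; the uniform bound on the coefficients makes the error uniform
  over \<open>Z\<close> (lemma \<open>near_free_if_A_precompact_ell2\<close>).

  Both directions rest on the Cauchy-Schwarz and triangle inequalities for algebra-valued forms, and
  these need the order of the algebra: sums of positive elements are positive, the norm is
  monotone on positive elements, and \<open>a\<^sup>*a\<close> is positive.  All of this is derived from the
  C*-identity by norm estimates.  A self-adjoint
  element \<open>h\<close> counts as positive if \<open>norm (t1 - h) \<le> t\<close> for some \<open>t\<close>.  Square roots come from an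
  elementary iteration (\<open>self_adjoint_sqrt\<close>), and norms are estimated by means of the fact that
  \<open>p + \<i>q\<close> is a multiple of a unitary when \<open>p, q\<close> are self-adjoint, commute and have \<open>p\<^sup>2 + q\<^sup>2\<close> scalar
  (\<open>norm_le_if_sum_of_squares\<close>).  The positivity of \<open>a\<^sup>*a\<close> then follows from an algebraic trick
  (\<open>norm_positive_minus_star_mult\<close>).  Spectra appear only in \<open>norm_positive_if_cstar_positive\<close>, which
  shows that elements that are positive in the spectral sense are positive in this sense.

  In the standard module, summability of the squares of a sum has to be proved before any inner product
  makes sense, so the inequalities are first established for finite columns and then carried over by
  the Cauchy criterion and by limits.
\<close>

section \<open>The involution and the norm\<close>

lemma scaleR_one_mult [simp]:
  fixes a :: "'a::unital_cstar_algebra"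
  shows "(r *\<^sub>R 1) * a = r *\<^sub>R a" "a * (r *\<^sub>R 1) = r *\<^sub>R a"
  by (simp_all add: mult_scaleR_left mult_scaleR_right)

lemma star_zero [simp]: "star (0::'a::unital_cstar_algebra) = 0"
  using star_add[of 0 "0::'a"] by simp

lemma star_uminus [simp]: "star (- a) = - star (a::'a::unital_cstar_algebra)"
  using star_add[of a "- a"] by (simp add: eq_neg_iff_add_eq_0 add.commute)

lemma star_diff [simp]: "star (a - b) = star a - star (b::'a::unital_cstar_algebra)"
  using star_add[of a "- b"] by simp

lemma star_one [simp]: "star (1::'a::unital_cstar_algebra) = 1"
  by (metis mult.right_neutral mult.left_neutral star_mult star_star)

lemma star_scaleR [simp]: "star (r *\<^sub>R a) = r *\<^sub>R star (a::'a::unital_cstar_algebra)"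
  by (simp add: scaleR_scaleC star_scaleC)

lemma star_sum: "star (\<Sum>i\<in>I. f i) = (\<Sum>i\<in>I. star (f i :: 'a::unital_cstar_algebra))"
  by (induction I rule: infinite_finite_induct) (simp_all add: star_add)

lemma norm_star [simp]: "norm (star a) = norm (a::'a::unital_cstar_algebra)"
proof -
  have le: "norm b \<le> norm (star b)" for b :: 'a
  proof (cases "b = 0")
    case False
    have "norm b * norm b \<le> norm (star b) * norm b"
      using norm_mult_ineq[of "star b" b] by (simp add: cstar_identity power2_eq_square)
    then show ?thesis using False by (simp add: mult_right_le_imp_le)
  qed simp
  from le[of a] le[of "star a"] show ?thesis by (simp add: star_star)
qed

text \<open>
  In the zero algebra the unit has norm 0, so only an inequality is available.
\<close>
lemma norm_one_le: "norm (1::'a::unital_cstar_algebra) \<le> 1"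
proof -
  have "norm (1::'a) * norm (1::'a) = norm (1::'a)"
    using cstar_identity[of "1::'a"] by (simp add: power2_eq_square)
  then show ?thesis by auto
qed

lemma norm_scaleR_one_le: "norm (r *\<^sub>R 1 :: 'a::unital_cstar_algebra) \<le> \<bar>r\<bar>"
  using mult_left_mono[OF norm_one_le[where 'a='a], of "\<bar>r\<bar>"] by simp

lemma norm_self_adjoint_square:
  fixes a :: "'a::unital_cstar_algebra"
  assumes "star a = a" shows "norm (a * a) = (norm a)\<^sup>2"
  using cstar_identity[of a] assms by simp

lemma square_eq_zero:
  fixes a :: "'a::unital_cstar_algebra"
  assumes "star a = a" "a * a = 0" shows "a = 0"
  using norm_self_adjoint_square[OF assms(1)] assms(2) by simp

lemma tendsto_star:
  fixes f :: "'b \<Rightarrow> 'a::unital_cstar_algebra"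
  assumes "(f \<longlongrightarrow> a) F" shows "((\<lambda>x. star (f x)) \<longlongrightarrow> star a) F"
proof -
  have "((\<lambda>x. norm (star (f x) - star a)) \<longlongrightarrow> 0) F"
    using tendsto_norm[OF LIM_zero[OF assms]] by (simp flip: star_diff)
  then show ?thesis using LIM_zero_cancel tendsto_norm_zero_iff by blast
qed

section \<open>Square roots of self-adjoint elements near the unit\<close>

text \<open>
  The fixed points \<open>q\<close> of \<open>q \<mapsto> (k + q\<^sup>2) / 2\<close> are exactly the solutions of \<open>(1 - q)\<^sup>2 = 1 - k\<close>.
  Starting the iteration at 0 produces real polynomials in \<open>k\<close> without constant term and with
  nonnegative coefficients; hence the scalar iteration for \<open>k = 1\<close> majorizes it.
\<close>
fun sqrt_iter :: "'a::unital_cstar_algebra \<Rightarrow> nat \<Rightarrow> 'a" where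
  "sqrt_iter k 0 = 0"
| "sqrt_iter k (Suc n) = (1/2) *\<^sub>R (k + sqrt_iter k n * sqrt_iter k n)"

fun sqrt_bound :: "nat \<Rightarrow> real" where
  "sqrt_bound 0 = 0"
| "sqrt_bound (Suc n) = (1 + (sqrt_bound n)\<^sup>2) / 2"

lemma sqrt_bound_range: "0 \<le> sqrt_bound n \<and> sqrt_bound n \<le> 1"
  by (induction n) (auto simp: power_le_one)

lemma sqrt_bound_mono: "sqrt_bound n \<le> sqrt_bound (Suc n)"
  using sum_power2_ge_zero[of "1 - sqrt_bound n" 0] by (simp add: power2_eq_square algebra_simps)

lemma sqrt_iter_commute:
  assumes "z * k = k * z" shows "z * sqrt_iter k n = sqrt_iter k n * z"
proof (induction n)
  case (Suc n)
  have "z * (sqrt_iter k n * sqrt_iter k n) = sqrt_iter k n * sqrt_iter k n * z"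
    using Suc by (metis mult.assoc)
  then show ?case using assms by (simp add: algebra_simps)
qed simp

lemma sqrt_iter_norm:
  fixes k :: "'a::unital_cstar_algebra"
  assumes "norm k \<le> 1" shows "norm (sqrt_iter k n) \<le> sqrt_bound n"
proof (induction n)
  case (Suc n)
  have "norm (k + sqrt_iter k n * sqrt_iter k n) \<le> 1 + sqrt_bound n * sqrt_bound n"
    by (rule norm_triangle_mono[OF assms order_trans[OF norm_mult_ineq mult_mono]])
       (use Suc sqrt_bound_range in auto)
  then show ?case by (simp add: power2_eq_square)
qed simp

lemma half_diff_squares: "(1 + s\<^sup>2) / 2 - (1 + t\<^sup>2) / 2 = (1/2) * ((s - t) * (s + t))" for s t :: real
  by (simp add: power2_eq_square field_simps)

text \<open>
  Consecutive iterates commute, so the increment of the iteration factors as half the product of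
  a difference and a sum.  The increments of the majorant factor in the same way, and the
  majorant telescopes to at most 1, which gives absolute convergence.
\<close>
lemma sqrt_iter_step:
  fixes k :: "'a::unital_cstar_algebra"
  assumes "norm k \<le> 1"
  shows "norm (sqrt_iter k (Suc n) - sqrt_iter k n) \<le> sqrt_bound (Suc n) - sqrt_bound n"
proof (induction n)
  case 0
  then show ?case using assms by simp
next
  case (Suc n)
  let ?a = "sqrt_iter k (Suc n)" and ?b = "sqrt_iter k n"
  let ?s = "sqrt_bound (Suc n)" and ?t = "sqrt_bound n"
  have comm: "?a * ?b = ?b * ?a"
    by (intro sqrt_iter_commute sqrt_iter_commute[symmetric]) simp
  have "sqrt_iter k (Suc (Suc n)) - ?a = (1/2) *\<^sub>R (?a * ?a - ?b * ?b)"
    by (simp only: sqrt_iter.simps(2)[of k "Suc n"] sqrt_iter.simps(2)[of k n]) (simp add: algebra_simps)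
  also have "?a * ?a - ?b * ?b = (?a - ?b) * (?a + ?b)"
    using comm by (simp only: algebra_simps)
  finally have eq: "sqrt_iter k (Suc (Suc n)) - ?a = (1/2) *\<^sub>R ((?a - ?b) * (?a + ?b))" .
  have "norm ((?a - ?b) * (?a + ?b)) \<le> (?s - ?t) * (?s + ?t)"
    by (rule order_trans[OF norm_mult_ineq mult_mono])
       (use Suc sqrt_iter_norm[OF assms] sqrt_bound_mono[of n] in
         \<open>auto intro: norm_triangle_mono simp del: sqrt_bound.simps sqrt_iter.simps\<close>)
  moreover have "sqrt_bound (Suc (Suc n)) - ?s = (1/2) * ((?s - ?t) * (?s + ?t))"
    using half_diff_squares[of ?s ?t] by (simp only: sqrt_bound.simps(2))
  ultimately show ?case unfolding eq by (simp del: sqrt_bound.simps sqrt_iter.simps)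
qed

text \<open>
  The limit of the iteration is \<open>q = 1 - s\<close>.  Since the iterates are polynomials in \<open>k\<close>,
  everything that commutes with \<open>k\<close> commutes with \<open>s\<close>; the bound on \<open>1 - s\<close> is what makes \<open>s\<close>
  positive below.
\<close>
lemma self_adjoint_sqrt:
  fixes k :: "'a::unital_cstar_algebra"
  assumes sa: "star k = k" and le: "norm k \<le> 1"
  obtains s where "star s = s" "norm (1 - s) \<le> 1" "s * s = 1 - k" "\<And>z. z * k = k * z \<Longrightarrow> z * s = s * z"
proof -
  have "summable (\<lambda>n. sqrt_bound (Suc n) - sqrt_bound n)"
  proof (rule summableI_nonneg_bounded)
    show "(\<Sum>i<n. sqrt_bound (Suc i) - sqrt_bound i) \<le> 1" for n
      unfolding sum_lessThan_telescope using sqrt_bound_range[of n] by simp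
  qed (simp only: diff_ge_0_iff_ge sqrt_bound_mono)
  then have "summable (\<lambda>n. sqrt_iter k (Suc n) - sqrt_iter k n)"
    by (rule summable_comparison_test'[where N=0]) (rule sqrt_iter_step[OF le])
  then obtain q where q: "sqrt_iter k \<longlonglongrightarrow> q"
    unfolding summable_iff_convergent sum_lessThan_telescope sqrt_iter.simps(1) diff_zero
    by (auto simp: convergent_def)
  have sa_iter: "star (sqrt_iter k n) = sqrt_iter k n" for n
    by (induction n) (simp_all add: sa star_add star_mult)
  have "star q = q"
    using LIMSEQ_unique[OF tendsto_star[OF q, unfolded sa_iter] q] .
  have "(\<lambda>n. sqrt_iter k (Suc n)) \<longlonglongrightarrow> (1/2) *\<^sub>R (k + q * q)"
    unfolding sqrt_iter.simps by (intro tendsto_intros q)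
  then have fixpt: "(1/2) *\<^sub>R (k + q * q) = q"
    using LIMSEQ_unique[OF _ LIMSEQ_Suc[OF q]] by blast
  show thesis
  proof
    show "star (1 - q) = 1 - q" using \<open>star q = q\<close> by simp
    have "norm (sqrt_iter k n) \<le> 1" for n
      using sqrt_iter_norm[OF le, of n] sqrt_bound_range[of n] by linarith
    then show "norm (1 - (1 - q)) \<le> 1"
      using Lim_bounded[OF tendsto_norm[OF q], of 0 1] by simp
    have "k + q * q = 2 *\<^sub>R q" using arg_cong[OF fixpt, of "\<lambda>x. 2 *\<^sub>R x"] by simp
    then show "(1 - q) * (1 - q) = 1 - k" by (simp add: algebra_simps scaleR_2)
    fix z assume z: "z * k = k * z"
    have "(\<lambda>n. z * sqrt_iter k n) \<longlonglongrightarrow> z * q" "(\<lambda>n. sqrt_iter k n * z) \<longlonglongrightarrow> q * z"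
      by (intro tendsto_intros q)+
    then have "z * q = q * z"
      using LIMSEQ_unique sqrt_iter_commute[OF z] by fastforce
    then show "z * (1 - q) = (1 - q) * z" by (simp add: algebra_simps)
  qed
qed

lemma scaleC_i [simp]: "\<i> *\<^sub>C \<i> *\<^sub>C a = - (a::'a::unital_cstar_algebra)"
  using scaleR_scaleC[of "-1" a] by (simp add: scaleC_scaleC)

lemma scaleC_uminus_left: "(- c) *\<^sub>C a = - (c *\<^sub>C (a::'a::unital_cstar_algebra))"
proof -
  have "0 *\<^sub>C a = 0" using scaleR_scaleC[of 0 a] by simp
  then show ?thesis using scaleC_add_left[of "-c" c a] by (simp add: eq_neg_iff_add_eq_0)
qed

lemma scaleC_diff_right: "c *\<^sub>C (a - b) = c *\<^sub>C a - c *\<^sub>C (b::'a::unital_cstar_algebra)"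
  using scaleC_add_right[of c "a - b" b] by (simp add: algebra_simps)

text \<open>
  For commuting self-adjoint \<open>p, q\<close> the element \<open>u = p + \<i>q\<close> satisfies \<open>u\<^sup>*u = p\<^sup>2 + q\<^sup>2\<close>, so it is a
  multiple of a unitary, and \<open>p\<close> is its real part.
\<close>
lemma norm_le_if_sum_of_squares:
  fixes p q :: "'a::unital_cstar_algebra"
  assumes "star p = p" "star q = q" "p * q = q * p" "p * p + q * q = c *\<^sub>R 1" "0 \<le> c"
  shows "(norm p)\<^sup>2 \<le> c"
proof -
  define u where "u = p + \<i> *\<^sub>C q"
  have su: "star u = p - \<i> *\<^sub>C q"
    using assms by (simp add: u_def star_add star_scaleC scaleC_uminus_left)
  have "star u * u = p * p + q * q"
    unfolding su unfolding u_def using assms(3)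
    by (simp add: algebra_simps mult_scaleC_left mult_scaleC_right scaleC_diff_right scaleC_add_right)
  then have "(norm u)\<^sup>2 \<le> c"
    using cstar_identity[of u] norm_scaleR_one_le[of c, where 'a='a] assms by simp
  moreover have "u + star u = 2 *\<^sub>R p" unfolding su by (simp add: u_def scaleR_2)
  then have "norm p \<le> norm u"
    using norm_triangle_ineq[of u "star u"] by simp
  ultimately show ?thesis by (meson norm_ge_zero order_trans power_mono)
qed

section \<open>Positivity expressed by the norm\<close>

text \<open>
  The inequality puts \<open>h\<close> into the ball of radius \<open>t\<close> around \<open>t1\<close>; for self-adjoint \<open>h\<close> its spectrum then lies
  in \<open>[0, 2t]\<close>.  In this form the closure under sums is just the triangle inequality.
\<close>

definition norm_positive :: "'a::unital_cstar_algebra \<Rightarrow> bool" where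
  "norm_positive h \<longleftrightarrow> star h = h \<and> (\<exists>t. norm (t *\<^sub>R 1 - h) \<le> t)"

lemma norm_positiveD: "norm_positive h \<Longrightarrow> star h = h" by (simp add: norm_positive_def)

lemma norm_positive_add: assumes "norm_positive h" "norm_positive k" shows "norm_positive (h + k)"
proof -
  from assms obtain s t where st: "norm (s *\<^sub>R 1 - h) \<le> s" "norm (t *\<^sub>R 1 - k) \<le> t"
    by (auto simp: norm_positive_def)
  have "norm ((s + t) *\<^sub>R 1 - (h + k)) \<le> s + t"
    using norm_triangle_mono[OF st] by (simp add: algebra_simps)
  then show ?thesis using assms by (auto simp: norm_positive_def star_add)
qed

lemma norm_positive_zero [simp]: "norm_positive 0" by (auto simp: norm_positive_def intro: exI[of _ 0])

lemma norm_positive_sum: "(\<And>i. i \<in> I \<Longrightarrow> norm_positive (f i)) \<Longrightarrow> norm_positive (\<Sum>i\<in>I. f i)"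
  by (induction I rule: infinite_finite_induct) (simp_all add: norm_positive_add)

lemma norm_positive_scaleR: assumes "norm_positive h" "0 \<le> c" shows "norm_positive (c *\<^sub>R h)"
proof -
  from assms obtain t where t: "norm (t *\<^sub>R 1 - h) \<le> t" by (auto simp: norm_positive_def)
  have "norm ((c * t) *\<^sub>R 1 - c *\<^sub>R h) \<le> c * t"
    using mult_left_mono[OF t assms(2)] assms(2) by (simp flip: scaleR_scaleR scaleR_diff_right)
  then show ?thesis using assms by (auto simp: norm_positive_def)
qed

lemma norm_positive_norm_minus: assumes "star h = h" "norm h \<le> c" shows "norm_positive (c *\<^sub>R 1 - h)"
  unfolding norm_positive_def using assms by (auto intro!: exI[of _ c])

text \<open>
  After scaling, \<open>norm b = 1\<close>.  Then \<open>1 - b\<^sup>2\<close> has a self-adjoint square root \<open>r\<close>, and \<open>b\<^sup>2 + r\<^sup>2 = 1\<close>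
  forces \<open>norm r \<le> 1\<close>; so \<open>b\<^sup>2\<close> has distance at most 1 from the unit.
\<close>
lemma norm_positive_square:
  fixes b :: "'a::unital_cstar_algebra"
  assumes sa: "star b = b" shows "norm_positive (b * b)"
proof (cases "b = 0")
  case False
  define p where "p = (1 / norm b) *\<^sub>R b"
  have p: "star p = p" "norm p = 1" using False sa by (simp_all add: p_def)
  have pp: "star (p * p) = p * p" "norm (p * p) \<le> 1"
    using p norm_self_adjoint_square[of p] by (simp_all add: star_mult)
  obtain r where r: "star r = r" "r * r = 1 - p * p"
      "\<And>z. z * (p * p) = p * p * z \<Longrightarrow> z * r = r * z"
    using self_adjoint_sqrt[OF pp] by metis
  have "p * r = r * p" by (rule r(3)) (simp add: mult.assoc)
  then have "(norm r)\<^sup>2 \<le> 1"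
    by (intro norm_le_if_sum_of_squares[OF r(1) p(1)]) (simp_all add: r(2))
  then have "norm (1 *\<^sub>R 1 - p * p) \<le> 1"
    using norm_self_adjoint_square[OF r(1)] unfolding r(2) by (simp only: scaleR_one)
  then have "norm_positive (p * p)" using pp unfolding norm_positive_def by blast
  moreover have "b * b = (norm b)\<^sup>2 *\<^sub>R (p * p)" using False by (simp add: p_def power2_eq_square)
  ultimately show ?thesis using norm_positive_scaleR[of "p * p" "(norm b)\<^sup>2"] by simp
qed simp

text \<open>
  Divided by \<open>t\<close>, an element with \<open>norm (t1 - h) \<le> t\<close> becomes \<open>1 - k\<close> with \<open>norm k \<le> 1\<close>.
\<close>
lemma norm_positive_sqrt:
  fixes h :: "'a::unital_cstar_algebra"
  assumes "norm_positive h"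
  obtains p where "norm_positive p" "p * p = h" "\<And>z. z * h = h * z \<Longrightarrow> z * p = p * z"
proof -
  obtain t0 where t0: "norm (t0 *\<^sub>R 1 - h) \<le> t0" using assms by (auto simp: norm_positive_def)
  \<comment> \<open>Increasing the radius by 1 makes it nonzero, so that division by it is possible.\<close>
  define t where "t = t0 + 1"
  have t: "t > 0" using t0 norm_ge_zero[of "t0 *\<^sub>R 1 - h"] unfolding t_def by linarith
  have "norm (t *\<^sub>R 1 - h) \<le> t"
    using norm_triangle_mono[OF t0 norm_one_le] by (simp add: t_def algebra_simps)
  then have le: "norm ((1 / t) *\<^sub>R (t *\<^sub>R 1 - h)) \<le> 1" using t by (simp del: scaleR_right_diff_distrib)
  have sa: "star ((1 / t) *\<^sub>R (t *\<^sub>R 1 - h)) = (1 / t) *\<^sub>R (t *\<^sub>R 1 - h)"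
    by (simp only: star_scaleR star_diff star_one norm_positiveD[OF assms])
  obtain s where s: "star s = s" "norm (1 - s) \<le> 1" "s * s = 1 - (1 / t) *\<^sub>R (t *\<^sub>R 1 - h)"
      "\<And>z. z * ((1 / t) *\<^sub>R (t *\<^sub>R 1 - h)) = (1 / t) *\<^sub>R (t *\<^sub>R 1 - h) * z \<Longrightarrow> z * s = s * z"
    using self_adjoint_sqrt[OF sa le] by metis
  show thesis
  proof
    have "norm_positive s" using s(1,2) by (auto simp: norm_positive_def intro!: exI[of _ 1])
    then show "norm_positive (sqrt t *\<^sub>R s)" using t by (intro norm_positive_scaleR) auto
    show "sqrt t *\<^sub>R s * sqrt t *\<^sub>R s = h" using t s(3) by (simp add: algebra_simps)
    fix z assume "z * h = h * z"
    then have "z * s = s * z" by (intro s(4)) (simp add: algebra_simps)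
    then show "z * sqrt t *\<^sub>R s = sqrt t *\<^sub>R s * z" by simp
  qed
qed

text \<open>
  Square roots of \<open>h\<close> and \<open>c1 - h\<close> can be chosen to commute, and their squares add up to \<open>c1\<close>.
\<close>
lemma norm_positive_norm_le:
  fixes h :: "'a::unital_cstar_algebra"
  assumes "norm_positive h" "norm_positive (c *\<^sub>R 1 - h)" "0 \<le> c"
  shows "norm h \<le> c"
proof -
  obtain p where p: "star p = p" "p * p = h" using norm_positive_sqrt[OF assms(1)] norm_positiveD by metis
  obtain q where q: "star q = q" "q * q = c *\<^sub>R 1 - h"
      "\<And>z. z * (c *\<^sub>R 1 - h) = (c *\<^sub>R 1 - h) * z \<Longrightarrow> z * q = q * z"
    using norm_positive_sqrt[OF assms(2)] norm_positiveD by metis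
  have "p * h = h * p" using p(2) by (metis mult.assoc)
  then have "p * q = q * p" by (intro q(3)) (simp add: algebra_simps)
  then have "(norm p)\<^sup>2 \<le> c" by (rule norm_le_if_sum_of_squares[OF p(1) q(1)]) (use p(2) q(2) assms(3) \<open>p * q = q * p\<close> in simp_all)
  then show ?thesis using norm_self_adjoint_square[OF p(1)] p(2) by simp
qed

lemma norm_positive_norm_mono:
  assumes "norm_positive h" "norm_positive (k - h)" shows "norm h \<le> norm k"
proof (rule norm_positive_norm_le[OF assms(1)])
  have "star k = k" using norm_positive_add[OF assms] norm_positiveD by force
  then have "norm_positive (norm k *\<^sub>R 1 - k)" by (intro norm_positive_norm_minus) auto
  from norm_positive_add[OF this assms(2)] show "norm_positive (norm k *\<^sub>R 1 - h)" by simp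
qed simp

lemma norm_positive_antisym: assumes "norm_positive h" "norm_positive (- h)" shows "h = 0"
  using norm_positive_norm_le[of h 0] assms by simp

lemma norm_positive_add_eq_zero: assumes "norm_positive h" "norm_positive k" "h + k = 0" shows "h = 0"
  using norm_positive_antisym[OF assms(1)] assms(2,3) by (metis add.inverse_unique)

lemma norm_positive_mult_commuting:
  fixes h k :: "'a::unital_cstar_algebra"
  assumes "norm_positive h" "norm_positive k" "h * k = k * h" shows "norm_positive (h * k)"
proof -
  obtain p where p: "star p = p" "p * p = h" "\<And>z. z * h = h * z \<Longrightarrow> z * p = p * z"
    using norm_positive_sqrt[OF assms(1)] norm_positiveD by metis
  obtain q where q: "star q = q" "q * q = k" "\<And>z. z * k = k * z \<Longrightarrow> z * q = q * z"
    using norm_positive_sqrt[OF assms(2)] norm_positiveD by metis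
  have pq: "p * q = q * p" using p(3)[of k] q(3)[of p] assms(3) by simp
  have "norm_positive ((p * q) * (p * q))" by (rule norm_positive_square) (simp add: star_mult p q pq)
  also have "(p * q) * (p * q) = h * k" using pq p(2) q(2) by (metis mult.assoc)
  finally show ?thesis .
qed

text \<open>
  Up to a factor 2, the sum is the sum of the squares of \<open>c + c\<^sup>*\<close> and \<open>\<i>(c - c\<^sup>*)\<close>.
\<close>
lemma norm_positive_star_mult_add:
  fixes c :: "'a::unital_cstar_algebra"
  shows "norm_positive (star c * c + c * star c)"
proof -
  let ?x = "c + star c" and ?y = "\<i> *\<^sub>C (c - star c)"
  have "star ?y = ?y"
    by (simp add: star_scaleC star_star scaleC_uminus_left scaleC_diff_right)
  then have "norm_positive (?x * ?x + ?y * ?y)"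
    by (intro norm_positive_add norm_positive_square) (simp_all add: star_add star_star add.commute)
  moreover have "?x * ?x + ?y * ?y = 2 *\<^sub>R (star c * c + c * star c)"
    by (simp add: mult_scaleC_left mult_scaleC_right scaleR_2 scaleC_diff_right scaleC_add_right algebra_simps)
  ultimately have "norm_positive (2 *\<^sub>R (star c * c + c * star c))" by metis
  from norm_positive_scaleR[OF this, of "1/2"] show ?thesis by simp
qed

text \<open>
  This is the crucial step towards the positivity of \<open>a\<^sup>*a\<close>.  Write \<open>h = -c\<^sup>*c = p\<^sup>2\<close>, \<open>k = cc\<^sup>*\<close> and \<open>x = cp\<close>: both
  \<open>x\<^sup>*x = -h\<^sup>2\<close> and \<open>xx\<^sup>* = -k\<^sup>2\<close> are negative, although their sum is positive.  So \<open>h\<^sup>2 + k\<^sup>2 = 0\<close>,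
  which leaves only \<open>h = 0\<close>.
\<close>
lemma norm_positive_minus_star_mult:
  fixes c :: "'a::unital_cstar_algebra"
  assumes "norm_positive (- (star c * c))" shows "c = 0"
proof -
  define h where "h = - (star c * c)"
  define k where "k = c * star c"
  have h: "norm_positive h" using assms by (simp add: h_def)
  have "star k = k" by (simp add: k_def star_mult star_star)
  obtain p where p: "star p = p" "p * p = h" using norm_positive_sqrt[OF h] norm_positiveD by metis
  define x where "x = c * p"
  have 1: "star x * x = - (h * h)"
  proof -
    have "star x * x = p * (star c * c) * p" by (simp add: x_def star_mult p mult.assoc)
    also have "\<dots> = - (p * (p * p) * p)" using p(2) by (simp add: h_def)
    also have "\<dots> = - (h * h)" by (simp add: mult.assoc flip: p(2))
    finally show ?thesis .
  qed
  have 2: "x * star x = - (k * k)"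
  proof -
    have "x * star x = c * (p * p) * star c" by (simp add: x_def star_mult p(1) mult.assoc)
    then show ?thesis unfolding p(2) by (simp add: h_def k_def mult.assoc)
  qed
  have hh: "norm_positive (h * h)" "norm_positive (k * k)" using norm_positive_square norm_positiveD[OF h] \<open>star k = k\<close> by auto
  have "norm_positive (- (h * h + k * k))" using norm_positive_star_mult_add[of x] unfolding 1 2 by simp
  then have "h * h + k * k = 0" using norm_positive_antisym norm_positive_add[OF hh] by blast
  then have "h * h = 0" using norm_positive_add_eq_zero hh by blast
  then have "h = 0" using square_eq_zero norm_positiveD[OF h] by blast
  then show ?thesis using cstar_identity[of c] by (simp add: h_def)
qed

text \<open>
  With \<open>b = a\<^sup>*a\<close> and \<open>r = |b|\<close>, the element \<open>g = r - b\<close> is twice the negative part of \<open>b\<close>.  Since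
  \<open>gb = -rg\<close>, the product \<open>(ag)\<^sup>*(ag) = -rg\<^sup>2\<close> is negative, so \<open>ag = 0\<close> by the previous lemma.  Then
  \<open>g\<^sup>3 = g\<^sup>2r - g\<^sup>2b = 0\<close>, hence \<open>g = 0\<close> and \<open>b = |b|\<close>.
\<close>
lemma norm_positive_star_mult:
  fixes a :: "'a::unital_cstar_algebra"
  shows "norm_positive (star a * a)"
proof -
  define b where "b = star a * a"
  have b: "star b = b" by (simp add: b_def star_mult star_star)
  obtain r where r: "norm_positive r" "r * r = b * b" "\<And>z. z * (b * b) = b * b * z \<Longrightarrow> z * r = r * z"
    using norm_positive_sqrt[OF norm_positive_square[OF b]] by metis
  have br: "b * r = r * b" by (rule r(3)) (simp add: mult.assoc)
  define g where "g = r - b"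
  have g: "star g = g" using norm_positiveD[OF r(1)] b by (simp add: g_def)
  have gb: "g * b = - (r * g)" using r(2) by (simp add: g_def algebra_simps)
  have rg: "r * g = g * r" using br by (simp add: g_def algebra_simps)
  have "star (a * g) * (a * g) = g * b * g" by (simp add: star_mult g b_def mult.assoc)
  also have "\<dots> = - (r * (g * g))" by (simp add: gb mult.assoc)
  finally have c: "star (a * g) * (a * g) = - (r * (g * g))" .
  have "norm_positive (r * (g * g))"
    by (rule norm_positive_mult_commuting[OF r(1) norm_positive_square[OF g]]) (metis rg mult.assoc)
  then have "a * g = 0" using norm_positive_minus_star_mult[of "a * g"] c by simp
  then have rgg: "r * (g * g) = 0" "b * g = 0" using c by (simp_all add: b_def mult.assoc)
  have "g * g * g = 0"
  proof -
    have "g * g * g = r * g * g - b * g * g" by (simp add: g_def algebra_simps)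
    then show ?thesis using rgg by (simp add: mult.assoc)
  qed
  then have "(g * g) * (g * g) = 0" by (simp flip: mult.assoc)
  then have "g = 0" using square_eq_zero g by (metis star_mult)
  then show ?thesis using r(1) by (simp add: g_def b_def)
qed

lemma divide_add_one_mult_le:
  fixes e y :: real assumes "0 < e" "0 \<le> y" shows "0 < e / (y + 1)" "e / (y + 1) * y \<le> e"
proof -
  have "0 < y + 1" using assms by simp
  then show "0 < e / (y + 1)" "e / (y + 1) * y \<le> e"
    using assms by (simp_all add: pos_divide_le_eq algebra_simps)
qed

lemma norm_positive_conjugate:
  fixes a h :: "'a::unital_cstar_algebra"
  assumes "norm_positive h" shows "norm_positive (star a * h * a)"
proof -
  obtain p where p: "star p = p" "p * p = h" using norm_positive_sqrt[OF assms] norm_positiveD by metis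
  have "star (p * a) * (p * a) = star a * (p * p) * a" by (simp add: star_mult p(1) mult.assoc)
  then show ?thesis using norm_positive_star_mult[of "p * a"] p(2) by simp
qed

lemma norm_positive_norm_diff_le:
  assumes "norm_positive h" "norm h \<le> c" shows "norm (c *\<^sub>R 1 - h) \<le> c"
proof (rule norm_positive_norm_le)
  show "norm_positive (c *\<^sub>R 1 - h)" using assms norm_positiveD norm_positive_norm_minus by blast
  show "0 \<le> c" using assms(2) norm_ge_zero[of h] by linarith
qed (use assms in simp)

text \<open>
  Let \<open>t\<^sub>0 \<ge> 0\<close> be the least shift that makes \<open>k = h + t\<^sub>01\<close> positive.  If \<open>t\<^sub>0 > 0\<close>, then \<open>-t\<^sub>0\<close> is not
  in the spectrum of \<open>h\<close>, so \<open>k\<close> is invertible.  For small \<open>d > 0\<close> the factor \<open>1 - dk\<inverse>\<close> is positive and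
  commutes with \<open>k\<close>, so that \<open>k(1 - dk\<inverse>) = k - d1\<close> is positive as well, which contradicts the choice
  of \<open>t\<^sub>0\<close>.
\<close>
lemma norm_positive_if_cstar_positive:
  fixes h :: "'a::unital_cstar_algebra"
  assumes "cstar_positive h" shows "norm_positive h"
proof -
  have sa: "star h = h" and spec: "cstar_spectrum h \<subseteq> complex_of_real ` {0..}"
    using assms by (auto simp: cstar_positive_def)
  define S where "S = {t. 0 \<le> t \<and> norm_positive (h + t *\<^sub>R 1)}"
  define t0 where "t0 = Inf S"
  have bdd: "bdd_below S" by (auto simp: S_def intro: bdd_belowI[of _ 0])
  have "norm_positive (norm h *\<^sub>R 1 - (- h))" by (rule norm_positive_norm_minus) (use sa in auto)
  then have ne: "S \<noteq> {}" by (auto simp: S_def add.commute intro: exI[of _ "norm h"])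
  have "0 \<le> t0" unfolding t0_def by (rule cInf_greatest[OF ne]) (auto simp: S_def)
  define k where "k = h + t0 *\<^sub>R 1"
  define T where "T = norm h + t0 + 1"
  \<comment> \<open>The infimum is attained: one radius T works for all shifts slightly above it.\<close>
  have "norm (T *\<^sub>R 1 - k) \<le> T + e" if "0 < e" for e
  proof -
    have "Inf S < t0 + min e 1" using that by (simp add: t0_def)
    from cInf_lessD[OF ne this] obtain t where t: "t \<in> S" "t < t0 + min e 1" by blast
    have "t0 \<le> t" unfolding t0_def by (rule cInf_lower[OF t(1) bdd])
    have "norm (h + t *\<^sub>R 1) \<le> norm h + \<bar>t\<bar>"
      by (rule norm_triangle_mono[OF order.refl norm_scaleR_one_le])
    also have "\<dots> \<le> T" using t by (simp add: T_def S_def)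
    finally have "norm (T *\<^sub>R 1 - (h + t *\<^sub>R 1)) \<le> T"
      using t(1) by (intro norm_positive_norm_diff_le) (simp_all add: S_def)
    from norm_triangle_mono[OF this norm_scaleR_one_le[of "t - t0"]]
    have "norm (T *\<^sub>R 1 - k) \<le> T + \<bar>t - t0\<bar>" by (simp add: k_def algebra_simps)
    then show ?thesis using t(2) \<open>t0 \<le> t\<close> by simp
  qed
  then have "norm (T *\<^sub>R 1 - k) \<le> T" by (rule field_le_epsilon)
  moreover have sk: "star k = k" by (simp add: k_def sa star_add)
  ultimately have k: "norm_positive k" unfolding norm_positive_def by blast
  have "t0 = 0"
  proof (rule ccontr)
    assume "t0 \<noteq> 0"
    then have "t0 > 0" using \<open>0 \<le> t0\<close> by simp
    then have "complex_of_real (- t0) \<notin> cstar_spectrum h"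
      using spec by (auto simp del: of_real_minus)
    then obtain b where b: "(complex_of_real (- t0) *\<^sub>C 1 - h) * b = 1"
        "b * (complex_of_real (- t0) *\<^sub>C 1 - h) = 1"
      unfolding cstar_spectrum_def by blast
    have mk: "complex_of_real (- t0) *\<^sub>C 1 - h = - k"
      unfolding scaleR_scaleC[symmetric] by (simp add: k_def)
    define c where "c = - b"
    have c: "k * c = 1" "c * k = 1" using b unfolding mk by (simp_all add: c_def)
    have "star c * k = 1" using arg_cong[OF c(1), of star] by (simp add: star_mult sk)
    then have sc: "star c = c" using c(1) by (metis mult.assoc mult.left_neutral mult.right_neutral)
    define d where "d = min t0 (1 / (norm c + 1))"
    have d: "0 < d" "d \<le> t0" "d * norm c \<le> 1"
    proof -
      show "0 < d" "d \<le> t0" using \<open>t0 > 0\<close> by (auto simp: d_def add_nonneg_pos)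
      have "d * norm c \<le> 1 / (norm c + 1) * norm c" by (intro mult_right_mono) (auto simp: d_def)
      also have "\<dots> \<le> 1" by (simp add: divide_simps add_nonneg_pos)
      finally show "d * norm c \<le> 1" .
    qed
    have "norm_positive (1 *\<^sub>R 1 - d *\<^sub>R c)" using sc d by (intro norm_positive_norm_minus) auto
    then have "norm_positive (k * (1 - d *\<^sub>R c))"
      by (intro norm_positive_mult_commuting[OF k]) (simp_all add: algebra_simps c)
    also have "k * (1 - d *\<^sub>R c) = h + (t0 - d) *\<^sub>R 1" by (simp add: right_diff_distrib c) (simp add: k_def algebra_simps)
    finally have "t0 - d \<in> S" using d by (simp add: S_def)
    then have "t0 \<le> t0 - d" unfolding t0_def by (rule cInf_lower[OF _ bdd])
    then show False using d by simp
  qed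
  then show ?thesis using k by (simp add: k_def)
qed

section \<open>The Cauchy-Schwarz inequality\<close>

text \<open>
  These axioms of a positive semidefinite form are shared by Hilbert modules and by columns of finite
  length, so that one proof of the Cauchy-Schwarz inequality serves both.
\<close>
locale semi_inner_module =
  fixes N :: "('a::unital_cstar_algebra, 'n::ab_group_add) inner_module"
  assumes zero_mem: "0 \<in> mcarrier N"
    and add_mem: "x \<in> mcarrier N \<Longrightarrow> y \<in> mcarrier N \<Longrightarrow> x + y \<in> mcarrier N"
    and act_mem: "x \<in> mcarrier N \<Longrightarrow> mact N x a \<in> mcarrier N"
    and act_minus_one: "x \<in> mcarrier N \<Longrightarrow> mact N x (- 1) = - x"
    and inner_add_right: "x \<in> mcarrier N \<Longrightarrow> y \<in> mcarrier N \<Longrightarrow> z \<in> mcarrier N \<Longrightarrow>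
          minner N x (y + z) = minner N x y + minner N x z"
    and inner_act_right: "x \<in> mcarrier N \<Longrightarrow> y \<in> mcarrier N \<Longrightarrow>
          minner N x (mact N y a) = minner N x y * a"
    and inner_star: "x \<in> mcarrier N \<Longrightarrow> y \<in> mcarrier N \<Longrightarrow> star (minner N x y) = minner N y x"
    and inner_norm_positive: "x \<in> mcarrier N \<Longrightarrow> norm_positive (minner N x x)"
begin

lemma uminus_mem: "x \<in> mcarrier N \<Longrightarrow> - x \<in> mcarrier N"
  using act_mem[of x "- 1"] act_minus_one by simp

lemma diff_mem: "x \<in> mcarrier N \<Longrightarrow> y \<in> mcarrier N \<Longrightarrow> x - y \<in> mcarrier N"
  using add_mem[of x "- y"] uminus_mem by simp

lemma sum_mem: "(\<And>i. i \<in> I \<Longrightarrow> f i \<in> mcarrier N) \<Longrightarrow> (\<Sum>i\<in>I. f i) \<in> mcarrier N"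
  by (induction I rule: infinite_finite_induct) (simp_all add: zero_mem add_mem)

lemma inner_add_left: "x \<in> mcarrier N \<Longrightarrow> y \<in> mcarrier N \<Longrightarrow> z \<in> mcarrier N \<Longrightarrow>
    minner N (x + y) z = minner N x z + minner N y z"
  using arg_cong[OF inner_add_right[of z x y], of star] by (simp add: star_add inner_star add_mem)

lemma inner_act_left: "x \<in> mcarrier N \<Longrightarrow> y \<in> mcarrier N \<Longrightarrow>
    minner N (mact N x a) y = star a * minner N x y"
  using arg_cong[OF inner_act_right[of y x a], of star] by (simp add: star_mult inner_star act_mem)

lemma inner_zero_right: "x \<in> mcarrier N \<Longrightarrow> minner N x 0 = 0"
  using inner_add_right[of x 0 0] zero_mem by simp

lemma inner_sum_right: "x \<in> mcarrier N \<Longrightarrow> (\<And>i. i \<in> I \<Longrightarrow> f i \<in> mcarrier N) \<Longrightarrow>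
    minner N x (\<Sum>i\<in>I. f i) = (\<Sum>i\<in>I. minner N x (f i))"
  by (induction I rule: infinite_finite_induct)
     (simp_all add: inner_zero_right inner_add_right sum_mem)

lemma mnorm_nonneg: "0 \<le> mnorm N x" by (simp add: mnorm_def)

lemma mnorm_square: "(mnorm N x)\<^sup>2 = norm (minner N x x)" by (simp add: mnorm_def)

text \<open>
  For \<open>a = \<langle>x,y\<rangle>\<close>, \<open>X = \<langle>x,x\<rangle>\<close>, \<open>Y = \<langle>y,y\<rangle>\<close> and \<open>t \<ge> norm X\<close>, expanding \<open>\<langle>xa - yt, xa - yt\<rangle> \<ge> 0\<close> and
  using \<open>a\<^sup>*Xa \<le> t a\<^sup>*a\<close> yields \<open>t a\<^sup>*a \<le> t\<^sup>2Y\<close>.  The number \<open>t\<close> is kept apart from \<open>norm X\<close>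
  because the latter may vanish, and division by \<open>t\<close> is needed.
\<close>
lemma Cauchy_Schwarz:
  assumes x: "x \<in> mcarrier N" and y: "y \<in> mcarrier N"
  shows "norm (minner N x y) \<le> mnorm N x * mnorm N y"
proof -
  define X where "X = minner N x x"
  define Y where "Y = minner N y y"
  define a where "a = minner N x y"
  have sa: "minner N y x = star a" using inner_star[OF x y] by (simp add: a_def)
  have bound: "(norm a)\<^sup>2 \<le> t * norm Y" if t: "norm X \<le> t" "0 < t" for t
  proof -
    have 1: "norm_positive (star a * (t *\<^sub>R 1 - X) * a)"
      using t norm_positiveD[OF inner_norm_positive[OF x]] by (intro norm_positive_conjugate norm_positive_norm_minus) (auto simp: X_def)
    define w where "w = mact N x a + mact N y ((- t) *\<^sub>R 1)"
    have 2: "norm_positive (minner N w w)" by (simp add: w_def inner_norm_positive add_mem act_mem x y)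
    have "minner N w w
        = star a * X * a - t *\<^sub>R (star a * a) - t *\<^sub>R (star a * a) + (t * t) *\<^sub>R Y"
      by (simp add: w_def inner_add_left inner_add_right inner_act_left inner_act_right add_mem
            act_mem x y sa flip: X_def Y_def a_def) (simp add: algebra_simps)
    then have "star a * (t *\<^sub>R 1 - X) * a + minner N w w = (t * t) *\<^sub>R Y - t *\<^sub>R (star a * a)"
      by (simp add: algebra_simps)
    then have "norm_positive ((t * t) *\<^sub>R Y - t *\<^sub>R (star a * a))" using norm_positive_add[OF 1 2] by (simp only:)
    from norm_positive_scaleR[OF this, of "1 / t"]
    have "norm_positive (t *\<^sub>R Y - star a * a)" using t(2) by (simp add: scaleR_diff_right)
    then have "norm (star a * a) \<le> norm (t *\<^sub>R Y)" by (rule norm_positive_norm_mono[OF norm_positive_star_mult])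
    then show ?thesis using t(2) by (simp add: cstar_identity)
  qed
  have "(norm a)\<^sup>2 \<le> norm X * norm Y"
  proof (rule field_le_epsilon)
    fix e :: real assume "0 < e"
    define d where "d = e / (norm Y + 1)"
    have d: "0 < d" "d * norm Y \<le> e"
      using divide_add_one_mult_le[OF \<open>0 < e\<close>, of "norm Y"] by (simp_all add: d_def)
    have "(norm a)\<^sup>2 \<le> (norm X + d) * norm Y" using d by (intro bound) (auto intro: add_nonneg_pos)
    then show "(norm a)\<^sup>2 \<le> norm X * norm Y + e" using d by (simp add: algebra_simps)
  qed
  then have "(norm a)\<^sup>2 \<le> (mnorm N x * mnorm N y)\<^sup>2"
    by (simp add: power_mult_distrib mnorm_square X_def Y_def)
  then show ?thesis unfolding a_def[symmetric]
    by (rule power2_le_imp_le) (simp add: mnorm_nonneg)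
qed

lemma mnorm_triangle:
  assumes x: "x \<in> mcarrier N" and y: "y \<in> mcarrier N"
  shows "mnorm N (x + y) \<le> mnorm N x + mnorm N y"
proof (rule power2_le_imp_le)
  have "minner N (x + y) (x + y) = minner N x x + minner N x y + (minner N y x + minner N y y)"
    by (simp add: inner_add_left inner_add_right add_mem x y)
  also have "norm \<dots> \<le> (norm (minner N x x) + norm (minner N x y)) +
      (norm (minner N y x) + norm (minner N y y))"
    by (intro norm_triangle_mono norm_triangle_ineq)
  finally show "(mnorm N (x + y))\<^sup>2 \<le> (mnorm N x + mnorm N y)\<^sup>2"
    using Cauchy_Schwarz[OF x y] Cauchy_Schwarz[OF y x]
    by (simp add: mnorm_square[symmetric] power2_sum algebra_simps)
qed (simp add: mnorm_nonneg)

lemma mnorm_act: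
  assumes x: "x \<in> mcarrier N"
  shows "mnorm N (mact N x a) \<le> mnorm N x * norm a"
proof (rule power2_le_imp_le)
  have "minner N (mact N x a) (mact N x a) = star a * (minner N x x * a)"
    by (simp add: inner_act_left inner_act_right act_mem x mult.assoc)
  also have "norm \<dots> \<le> norm (star a) * (norm (minner N x x) * norm a)"
    by (meson norm_mult_ineq mult_left_mono norm_ge_zero order_trans)
  finally show "(mnorm N (mact N x a))\<^sup>2 \<le> (mnorm N x * norm a)\<^sup>2"
    by (simp add: mnorm_square[symmetric] power_mult_distrib) (simp add: power2_eq_square mult_ac)
qed (simp add: mnorm_nonneg)

lemma mnorm_minus_le:
  assumes x: "x \<in> mcarrier N" shows "mnorm N (- x) \<le> mnorm N x"
proof -
  have "mnorm N x * norm (- 1 :: 'a) \<le> mnorm N x"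
    using mult_left_mono[OF norm_one_le mnorm_nonneg[of x]] by simp
  then show ?thesis using mnorm_act[OF x, of "- 1"] act_minus_one[OF x] by simp
qed

end

sublocale hilbert_module \<subseteq> semi_inner_module
proof
  fix x assume x: "x \<in> mcarrier N"
  have "mact N x 0 = 0" using act_add_right[OF x, of 0 0] by simp
  then show "mact N x (- 1) = - x"
    using act_add_right[OF x, of "- 1" 1] act_one[OF x] by (simp add: eq_neg_iff_add_eq_0)
qed (simp_all add: zero_mem add_mem act_mem inner_add_right inner_act_right inner_star inner_positive
      norm_positive_if_cstar_positive)

section \<open>Approximation by free submodules implies precompactness\<close>

text \<open>
  The orthonormal basis of the free submodule serves as the finite system.  The coefficients of an
  approximant \<open>y\<close> are \<open>\<langle>e\<^sub>k, y\<rangle>\<close>, so the Cauchy-Schwarz inequality bounds them by \<open>mnorm y\<close>, which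
  exceeds the bound for \<open>Z\<close> by at most \<open>\<epsilon>\<close>.
\<close>
lemma A_precompact_if_near_free:
  fixes N :: "('a::unital_cstar_algebra, 'n::ab_group_add) inner_module"
  assumes N: "hilbert_module N" and Z: "Z \<subseteq> mcarrier N" and bdd: "mbounded N Z"
    and near: "\<And>\<epsilon>. \<epsilon> > 0 \<Longrightarrow>
      \<exists>L. free_fg_submodule N L \<and> (\<forall>x\<in>Z. module_dist N x L < \<epsilon>)"
  shows "A_precompact N Z"
proof -
  interpret hilbert_module N by (rule N)
  obtain C where C: "\<And>x. x \<in> Z \<Longrightarrow> mnorm N x \<le> C" using bdd by (auto simp: mbounded_def)
  show ?thesis unfolding A_precompact_def
  proof (intro conjI Z bdd allI impI)
    fix \<epsilon> :: real assume \<epsilon>: "\<epsilon> > 0"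
    from near[OF \<epsilon>] obtain L where L: "free_fg_submodule N L" "\<And>x. x \<in> Z \<Longrightarrow> module_dist N x L < \<epsilon>"
      by blast
    from L(1)[unfolded free_fg_submodule_def] obtain n :: nat and e where Lsub: "L \<subseteq> mcarrier N"
      and e: "\<forall>i<n. e i \<in> L"
      and on: "\<forall>i<n. \<forall>j<n. minner N (e i) (e j) = (if i = j then 1 else 0)"
      and Leq: "L = range (\<lambda>a. \<Sum>i<n. mact N (e i) (a i))"
      by blast
    have em: "e i \<in> mcarrier N" if "i < n" for i using e that Lsub by blast
    have orth: "minner N (e i) (e j) = (if i = j then 1 else 0)" if "i < n" "j < n" for i j
      using on that by blast
    have approx: "\<exists>a. (\<forall>k<n. norm (a k) \<le> \<bar>C\<bar> + \<epsilon>) \<and>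
        mnorm N (x - (\<Sum>k<n. mact N (e k) (a k))) < \<epsilon>" if x: "x \<in> Z" for x
    proof -
      have xm: "x \<in> mcarrier N" using x Z by blast
      have "(\<lambda>y. mnorm N (x - y)) ` L \<noteq> {}" unfolding Leq by blast
      from cInf_lessD[OF this] obtain y where y: "y \<in> L" "mnorm N (x - y) < \<epsilon>"
        using L(2)[OF x] unfolding module_dist_def by blast
      obtain a where a: "y = (\<Sum>i<n. mact N (e i) (a i))" using y(1) Leq by blast
      have ym: "y \<in> mcarrier N" using y(1) Lsub by blast
      have "norm (a k) \<le> \<bar>C\<bar> + \<epsilon>" if k: "k < n" for k
      proof -
        have "minner N (e k) y = (\<Sum>i<n. minner N (e k) (e i) * a i)"
          unfolding a by (subst inner_sum_right[OF em[OF k]]) (auto simp: inner_act_right em act_mem k)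
        also have "\<dots> = (\<Sum>i<n. if k = i then a i else 0)"
          by (rule sum.cong) (auto simp: orth k)
        also have "\<dots> = a k" using k by (simp add: sum.delta)
        finally have "norm (a k) \<le> mnorm N (e k) * mnorm N y"
          using Cauchy_Schwarz[OF em[OF k] ym] by simp
        also have "\<dots> \<le> 1 * mnorm N y"
          by (rule mult_right_mono) (use orth[OF k k] norm_one_le in \<open>auto simp: mnorm_def\<close>)
        also have "mnorm N y \<le> mnorm N x + mnorm N (- (x - y))"
          using mnorm_triangle[OF xm uminus_mem[OF diff_mem[OF xm ym]]] by simp
        also have "\<dots> \<le> \<bar>C\<bar> + \<epsilon>"
          using C[OF x] y(2) mnorm_minus_le[OF diff_mem[OF xm ym]] by simp
        finally show ?thesis by simp
      qed
      then show ?thesis using y(2) a by blast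
    qed
    show "\<exists>M>0. \<exists>(s::nat) z. (\<forall>k<s. z k \<in> mcarrier N) \<and>
       (\<forall>x\<in>Z. \<exists>a. (\<forall>k<s. norm (a k) \<le> M) \<and>
          mnorm N (x - (\<Sum>k<s. mact N (z k) (a k))) < \<epsilon>)"
      using em approx \<epsilon> by (intro exI[of _ "\<bar>C\<bar> + \<epsilon>"] exI[of _ n] exI[of _ e] conjI) auto
  qed
qed

section \<open>The norm of the standard module\<close>

text \<open>
  Columns with entries indexed by all of \<open>'j\<close>, of which the form sees only those in \<open>F\<close>.  For finite
  \<open>F\<close> these forms approximate the one of the standard module, and they are defined on one common
  carrier, so that no summability has to be known before they are used.
\<close>
definition column_module :: "'j set \<Rightarrow> ('a::unital_cstar_algebra, 'j \<Rightarrow> 'a) inner_module" where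
  "column_module F = \<lparr> mcarrier = UNIV, mact = (\<lambda>x a j. x j * a),
     minner = (\<lambda>x y. \<Sum>j\<in>F. star (x j) * y j) \<rparr>"

lemma semi_inner_module_column: "semi_inner_module (column_module F)"
  by unfold_locales
     (auto simp: column_module_def fun_eq_iff sum.distrib sum_distrib_right distrib_left mult.assoc
        star_sum star_mult star_star intro!: norm_positive_sum norm_positive_star_mult)

lemma summable_on_Cauchy_iff:
  fixes f :: "'j \<Rightarrow> 'a::banach"
  shows "f summable_on A \<longleftrightarrow> (\<forall>e>0. \<exists>F0. finite F0 \<and> F0 \<subseteq> A \<and>
           (\<forall>F. finite F \<longrightarrow> F \<subseteq> A - F0 \<longrightarrow> norm (sum f F) < e))" (is "_ \<longleftrightarrow> ?R")
proof
  assume f: "f summable_on A"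
  show ?R
  proof (intro allI impI)
    fix e :: real assume "0 < e"
    then have "0 < e / 2" by simp
    from tendstoD[OF infsum_tendsto[OF f] this]
    have "\<exists>F0. finite F0 \<and> F0 \<subseteq> A \<and> (\<forall>F. finite F \<and> F0 \<subseteq> F \<and> F \<subseteq> A \<longrightarrow>
        dist (sum f F) (infsum f A) < e / 2)"
      by (simp only: eventually_finite_subsets_at_top)
    then obtain F0 where F0: "finite F0" "F0 \<subseteq> A"
      "\<And>F. finite F \<Longrightarrow> F0 \<subseteq> F \<Longrightarrow> F \<subseteq> A \<Longrightarrow> dist (sum f F) (infsum f A) < e / 2"
      by (elim exE conjE) simp
    have "norm (sum f F) < e" if F: "finite F" "F \<subseteq> A - F0" for F
    proof -
      have "sum f F = sum f (F0 \<union> F) - sum f F0"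
        using F F0(1) by (subst sum.union_disjoint) auto
      moreover have "dist (sum f (F0 \<union> F)) (infsum f A) < e / 2" "dist (sum f F0) (infsum f A) < e / 2"
        using F F0(1,2) by (intro F0(3); blast)+
      ultimately show ?thesis
        using dist_triangle_half_l[of "sum f (F0 \<union> F)" "infsum f A" e "sum f F0"]
        by (simp add: dist_norm)
    qed
    then show "\<exists>F0. finite F0 \<and> F0 \<subseteq> A \<and> (\<forall>F. finite F \<longrightarrow> F \<subseteq> A - F0 \<longrightarrow> norm (sum f F) < e)"
      using F0 by blast
  qed
next
  assume R: ?R
  have "\<exists>P. eventually P (finite_subsets_at_top A) \<and>
          (\<forall>F G. P F \<and> P G \<longrightarrow> dist (sum f F) (sum f G) < e)" if "0 < e" for e
  proof -
    have "0 < e / 2" using that by simp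
    then obtain F0 where F0: "finite F0" "F0 \<subseteq> A"
      "\<forall>F. finite F \<longrightarrow> F \<subseteq> A - F0 \<longrightarrow> norm (sum f F) < e / 2"
      using R by meson
    define P where "P F \<longleftrightarrow> finite F \<and> F0 \<subseteq> F \<and> F \<subseteq> A" for F
    have "eventually P (finite_subsets_at_top A)"
      unfolding P_def eventually_finite_subsets_at_top using F0(1,2) by blast
    moreover have "dist (sum f F) (sum f G) < e" if "P F" "P G" for F G
    proof -
      have near: "dist (sum f H) (sum f F0) < e / 2" if "P H" for H
        using that F0(3)[rule_format, of "H - F0"] by (auto simp: P_def dist_norm sum_diff)
      show ?thesis by (rule dist_triangle_half_l[OF near near]) (fact that)+
    qed
    ultimately show ?thesis by blast
  qed
  then have "cauchy_filter (filtermap (sum f) (finite_subsets_at_top A))"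
    by (simp add: cauchy_filter_metric_filtermap)
  moreover have "complete (UNIV :: 'a set)"
    by (meson Cauchy_convergent UNIV_I complete_def convergent_def)
  ultimately obtain L where "(sum f \<longlongrightarrow> L) (finite_subsets_at_top A)"
    using complete_uniform[where S=UNIV] by (force simp add: filterlim_def)
  then show "f summable_on A" using summable_on_def has_sum_def by blast
qed

lemma ell2_mem:
  "x \<in> mcarrier (ell2 J) \<longleftrightarrow> (\<forall>j. j \<notin> J \<longrightarrow> x j = 0) \<and> (\<lambda>j. star (x j) * x j) summable_on J"
  by (simp add: ell2_def)

lemma mact_ell2: "mact (ell2 J) x a = (\<lambda>j. x j * a)"
  by (simp add: ell2_def)

lemma mnorm_column_tendsto_ell2:
  assumes "x \<in> mcarrier (ell2 J)"
  shows "((\<lambda>F. mnorm (column_module F) x) \<longlongrightarrow> mnorm (ell2 J) x) (finite_subsets_at_top J)"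
  unfolding mnorm_def using assms
  by (auto simp: ell2_def column_module_def intro!: tendsto_intros infsum_tendsto)

text \<open>
  By the triangle inequality for finite columns, the partial sums for \<open>x + y\<close> over sets far out in
  \<open>J\<close> are small; so the Cauchy criterion applies.
\<close>
lemma ell2_add_mem:
  fixes x y :: "'j \<Rightarrow> 'a::unital_cstar_algebra"
  assumes x: "x \<in> mcarrier (ell2 J)" and y: "y \<in> mcarrier (ell2 J)"
  shows "x + y \<in> mcarrier (ell2 J)"
proof -
  let ?q = "\<lambda>x j. star (x j) * x j :: 'a"
  have mcol: "(mnorm (column_module F) z)\<^sup>2 = norm (sum (?q z) F)" for z and F :: "'j set"
    by (simp add: mnorm_def column_module_def)
  have "?q (x + y) summable_on J"
    unfolding summable_on_Cauchy_iff
  proof (intro allI impI)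
    fix e :: real assume "0 < e"
    then have e: "0 < e / 4" by simp
    obtain F where F: "finite F" "F \<subseteq> J" "\<forall>G. finite G \<longrightarrow> G \<subseteq> J - F \<longrightarrow> norm (sum (?q x) G) < e / 4"
      using x e unfolding ell2_mem summable_on_Cauchy_iff by meson
    obtain F' where F': "finite F'" "F' \<subseteq> J" "\<forall>G. finite G \<longrightarrow> G \<subseteq> J - F' \<longrightarrow> norm (sum (?q y) G) < e / 4"
      using y e unfolding ell2_mem summable_on_Cauchy_iff by meson
    have "norm (sum (?q (x + y)) G) < e" if G: "finite G" "G \<subseteq> J - (F \<union> F')" for G
    proof -
      interpret col: semi_inner_module "column_module G :: ('a, 'j \<Rightarrow> 'a) inner_module"
        by (rule semi_inner_module_column)
      have half: "mnorm (column_module G) z < sqrt e / 2" if "norm (sum (?q z) G) < e / 4" for z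
      proof (rule power2_less_imp_less)
        show "(mnorm (column_module G) z)\<^sup>2 < (sqrt e / 2)\<^sup>2"
          unfolding mcol using that \<open>0 < e\<close> by (simp add: power_divide)
      qed (use \<open>0 < e\<close> in simp)
      have "mnorm (column_module G) (x + y) \<le> mnorm (column_module G) x + mnorm (column_module G) y"
        by (rule col.mnorm_triangle) (simp_all add: column_module_def)
      also have "\<dots> < sqrt e"
        using half[of x] half[of y] F(3)[rule_format, of G] F'(3)[rule_format, of G] G by fastforce
      finally have "(mnorm (column_module G) (x + y))\<^sup>2 < (sqrt e)\<^sup>2"
        using col.mnorm_nonneg by (intro power_strict_mono) auto
      then show ?thesis unfolding mcol using \<open>0 < e\<close> by simp
    qed
    then show "\<exists>F0. finite F0 \<and> F0 \<subseteq> J \<and>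
        (\<forall>G. finite G \<longrightarrow> G \<subseteq> J - F0 \<longrightarrow> norm (sum (?q (x + y)) G) < e)"
      using F(1,2) F'(1,2) by (intro exI[of _ "F \<union> F'"]) auto
  qed
  then show ?thesis using x y by (simp add: ell2_mem)
qed

lemma ell2_act_mem:
  assumes "x \<in> mcarrier (ell2 J)" shows "mact (ell2 J) x a \<in> mcarrier (ell2 J)"
proof -
  have "(\<lambda>j. star a * (star (x j) * x j) * a) summable_on J"
    using assms by (intro summable_on_cmult_left summable_on_cmult_right) (simp add: ell2_mem)
  then show ?thesis using assms by (simp add: ell2_mem mact_ell2 star_mult mult.assoc)
qed

lemma ell2_finite_support_mem:
  assumes "finite F" "F \<subseteq> J" "\<And>j. j \<notin> F \<Longrightarrow> x j = 0"
  shows "x \<in> mcarrier (ell2 J)"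
proof -
  have "(\<lambda>j. star (x j) * x j) summable_on J \<longleftrightarrow> (\<lambda>j. star (x j) * x j) summable_on F"
    by (rule summable_on_cong_neutral) (use assms in auto)
  then show ?thesis using assms by (auto simp: ell2_mem)
qed

lemma ell2_sum_mem:
  "(\<And>i. i \<in> I \<Longrightarrow> f i \<in> mcarrier (ell2 J)) \<Longrightarrow> (\<Sum>i\<in>I. f i) \<in> mcarrier (ell2 J)"
  by (induction I rule: infinite_finite_induct)
     (auto intro: ell2_add_mem ell2_finite_support_mem[of "{}"])

lemma ell2_diff_mem:
  assumes "x \<in> mcarrier (ell2 J)" "y \<in> mcarrier (ell2 J)" shows "x - y \<in> mcarrier (ell2 J)"
proof -
  have "x - y = x + mact (ell2 J) y (- 1)" by (simp add: fun_eq_iff mact_ell2)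
  then show ?thesis using ell2_add_mem ell2_act_mem assms by metis
qed

text \<open>
  The inequality holds for each finite set of coordinates and passes to the limit.
\<close>
lemma ell2_mnorm_triangle:
  fixes x y :: "'j \<Rightarrow> 'a::unital_cstar_algebra"
  assumes "x \<in> mcarrier (ell2 J)" "y \<in> mcarrier (ell2 J)"
  shows "mnorm (ell2 J) (x + y) \<le> mnorm (ell2 J) x + mnorm (ell2 J) y"
proof (rule tendsto_le[OF finite_subsets_at_top_neq_bot
      tendsto_add[OF mnorm_column_tendsto_ell2[OF assms(1)] mnorm_column_tendsto_ell2[OF assms(2)]]
      mnorm_column_tendsto_ell2[OF ell2_add_mem[OF assms]]])
  show "\<forall>\<^sub>F F in finite_subsets_at_top J. mnorm (column_module F) (x + y)
      \<le> mnorm (column_module F) x + mnorm (column_module F) y"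
    by (intro always_eventually allI semi_inner_module.mnorm_triangle[OF semi_inner_module_column])
       (simp_all add: column_module_def)
qed

lemma ell2_mnorm_act:
  fixes x :: "'j \<Rightarrow> 'a::unital_cstar_algebra"
  assumes "x \<in> mcarrier (ell2 J)"
  shows "mnorm (ell2 J) (mact (ell2 J) x a) \<le> mnorm (ell2 J) x * norm a"
proof (rule tendsto_le[OF finite_subsets_at_top_neq_bot
      tendsto_mult[OF mnorm_column_tendsto_ell2[OF assms] tendsto_const]
      mnorm_column_tendsto_ell2[OF ell2_act_mem[OF assms]]])
  have "mnorm (column_module F) (mact (column_module F) x a) \<le> mnorm (column_module F) x * norm a"
    for F :: "'j set"
    by (rule semi_inner_module.mnorm_act[OF semi_inner_module_column]) (simp add: column_module_def)
  then show "\<forall>\<^sub>F F in finite_subsets_at_top J. mnorm (column_module F) (mact (ell2 J) x a)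
      \<le> mnorm (column_module F) x * norm a"
    by (intro always_eventually allI) (simp add: mact_ell2 column_module_def)
qed

lemma ell2_mnorm_sum:
  "(\<And>i. i \<in> I \<Longrightarrow> f i \<in> mcarrier (ell2 J)) \<Longrightarrow>
    mnorm (ell2 J) (\<Sum>i\<in>I. f i) \<le> (\<Sum>i\<in>I. mnorm (ell2 J) (f i))"
proof (induction I rule: infinite_finite_induct)
  case (insert i I)
  have "mnorm (ell2 J) (f i + sum f I) \<le> mnorm (ell2 J) (f i) + mnorm (ell2 J) (sum f I)"
    by (intro ell2_mnorm_triangle ell2_sum_mem) (simp_all add: insert.prems)
  also have "mnorm (ell2 J) (sum f I) \<le> (\<Sum>i\<in>I. mnorm (ell2 J) (f i))"
    by (rule insert.IH) (simp add: insert.prems)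
  finally show ?case by (simp only: sum.insert[OF insert.hyps])
qed (simp_all add: mnorm_def ell2_def)

section \<open>Precompactness implies approximation by free submodules\<close>

definition restrict_coords :: "'j set \<Rightarrow> ('j \<Rightarrow> 'a::zero) \<Rightarrow> 'j \<Rightarrow> 'a" where
  "restrict_coords F x = (\<lambda>j. if j \<in> F then x j else 0)"

lemma ell2_restrict_coords_mem: "finite F \<Longrightarrow> F \<subseteq> J \<Longrightarrow> restrict_coords F x \<in> mcarrier (ell2 J)"
  by (rule ell2_finite_support_mem) (auto simp: restrict_coords_def)

lemma ell2_restrict_coords_approx:
  fixes x :: "'j \<Rightarrow> 'a::unital_cstar_algebra"
  assumes x: "x \<in> mcarrier (ell2 J)" and "0 < \<delta>"
  shows "\<forall>\<^sub>F F in finite_subsets_at_top J. mnorm (ell2 J) (x - restrict_coords F x) < \<delta>"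
proof -
  let ?f = "\<lambda>j. star (x j) * x j"
  have f: "?f summable_on J" using x by (simp add: ell2_mem)
  have "0 < \<delta>\<^sup>2" using \<open>0 < \<delta>\<close> by simp
  from tendstoD[OF infsum_tendsto[OF f] this]
  have "\<forall>\<^sub>F F in finite_subsets_at_top J. dist (sum ?f F) (infsum ?f J) < \<delta>\<^sup>2" .
  moreover have "\<forall>\<^sub>F F in finite_subsets_at_top J. finite F \<and> F \<subseteq> J"
    by (simp add: eventually_finite_subsets_at_top_weakI)
  ultimately show ?thesis
  proof eventually_elim
    case (elim F)
    have "minner (ell2 J) (x - restrict_coords F x) (x - restrict_coords F x) = infsum ?f (J - F)"
      by (simp add: ell2_def restrict_coords_def) (rule infsum_cong_neutral, auto)
    also have "\<dots> = infsum ?f J - sum ?f F"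
      using elim f infsum_Diff[of ?f J F] by simp
    finally have "(mnorm (ell2 J) (x - restrict_coords F x))\<^sup>2 < \<delta>\<^sup>2"
      using elim by (simp add: mnorm_def dist_norm norm_minus_commute)
    then show ?case by (rule power2_less_imp_less) (use \<open>0 < \<delta>\<close> in simp)
  qed
qed

lemma sum_fun_apply: "(\<Sum>i\<in>I. f i) j = (\<Sum>i\<in>I. f i j :: 'a::comm_monoid_add)"
  by (induction I rule: infinite_finite_induct) simp_all

lemma ell2_coordinate_submodule_free:
  fixes F :: "'j set"
  assumes "finite F" "F \<subseteq> J"
  shows "free_fg_submodule (ell2 J) {x :: 'j \<Rightarrow> 'a::unital_cstar_algebra. \<forall>j. j \<notin> F \<longrightarrow> x j = 0}"
    (is "free_fg_submodule _ ?L")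
proof -
  obtain g where g: "bij_betw g {..<card F} F"
    using ex_bij_betw_nat_finite[OF assms(1)] by (auto simp: lessThan_atLeast0)
  define e where "e i j = (if j = g i then 1 else 0 :: 'a)" for i j
  have gF: "g i \<in> F" if "i < card F" for i using g that bij_betwE by blast
  have on: "minner (ell2 J) (e i) (e k) = (if i = k then 1 else 0)" if i: "i < card F" and k: "k < card F" for i k
  proof -
    have "minner (ell2 J) (e i) (e k) = infsum (\<lambda>j. star (e i j) * e k j) {g i}"
      using gF[OF i] assms unfolding ell2_def inner_module.simps by (intro infsum_cong_neutral) (auto simp: e_def)
    moreover have "g i = g k \<longleftrightarrow> i = k"
      using g i k by (auto simp: bij_betw_def inj_on_def)
    ultimately show ?thesis by (simp add: e_def)
  qed
  have comb: "(\<Sum>i<card F. mact (ell2 J) (e i) (a i)) j = (\<Sum>i<card F. if j = g i then a i else 0)" for a j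
    unfolding sum_fun_apply by (rule sum.cong) (auto simp: mact_ell2 e_def)
  have "?L = range (\<lambda>a. \<Sum>i<card F. mact (ell2 J) (e i) (a i))"
  proof (intro equalityI subsetI)
    fix x assume x: "x \<in> ?L"
    have "x = (\<Sum>i<card F. mact (ell2 J) (e i) (x (g i)))"
    proof
      fix j
      have "(\<Sum>i<card F. if j = g i then x (g i) else 0) = (\<Sum>l\<in>F. if j = l then x l else 0)"
        using sum.reindex_bij_betw[OF g] .
      then show "x j = (\<Sum>i<card F. mact (ell2 J) (e i) (x (g i))) j"
        unfolding comb using x assms(1) by (simp add: sum.delta)
    qed
    then show "x \<in> range (\<lambda>a. \<Sum>i<card F. mact (ell2 J) (e i) (a i))"
      by (rule range_eqI[where x = "\<lambda>i. x (g i)"])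
  next
    fix x assume "x \<in> range (\<lambda>a. \<Sum>i<card F. mact (ell2 J) (e i) (a i))"
    then show "x \<in> ?L" using gF by (auto simp: comb intro!: sum.neutral)
  qed
  moreover have "?L \<subseteq> mcarrier (ell2 J)" using ell2_finite_support_mem[OF assms] by blast
  moreover have "\<forall>i<card F. e i \<in> ?L" using gF by (auto simp: e_def)
  ultimately show ?thesis unfolding free_fg_submodule_def using on
    by (intro conjI exI[of _ "card F"] exI[of _ e]) simp_all
qed

text \<open>
  The coordinates outside a large finite set \<open>F\<close> contribute little to the finitely many vectors \<open>z\<^sub>k\<close>, and
  the coefficients are bounded by \<open>M\<close> for all elements of \<open>Z\<close> simultaneously.  Hence replacing each
  \<open>z\<^sub>k\<close> by its restriction to \<open>F\<close> changes the approximants uniformly little and moves them into the free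
  submodule of vectors supported in \<open>F\<close>.
\<close>
lemma near_free_if_A_precompact_ell2:
  fixes J :: "'j set" and Z :: "('j \<Rightarrow> 'a::unital_cstar_algebra) set"
  assumes pre: "A_precompact (ell2 J) Z" and \<epsilon>: "0 < \<epsilon>"
  shows "\<exists>L. free_fg_submodule (ell2 J) L \<and> (\<forall>x\<in>Z. module_dist (ell2 J) x L < \<epsilon>)"
proof -
  let ?N = "ell2 J :: ('a, 'j \<Rightarrow> 'a) inner_module"
  have Z: "Z \<subseteq> mcarrier ?N" using pre by (simp add: A_precompact_def)
  have "0 < \<epsilon> / 2" using \<epsilon> by simp
  with pre obtain M and s :: nat and z where M: "0 < M"
    and z: "\<forall>k<s. z k \<in> mcarrier ?N"
    and approx: "\<forall>x\<in>Z. \<exists>a. (\<forall>k<s. norm (a k) \<le> M) \<and>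
          mnorm ?N (x - (\<Sum>k<s. mact ?N (z k) (a k))) < \<epsilon> / 2"
    unfolding A_precompact_def by blast
  \<comment> \<open>s vectors with coefficients of norm at most M must together contribute at most half of the error.\<close>
  define \<delta> where "\<delta> = \<epsilon> / 2 / (s * M + 1)"
  have \<delta>: "0 < \<delta>" "\<delta> * (s * M) \<le> \<epsilon> / 2"
    using divide_add_one_mult_le[OF \<open>0 < \<epsilon> / 2\<close>, of "s * M"] M by (simp_all add: \<delta>_def)
  have "\<forall>\<^sub>F F in finite_subsets_at_top J. \<forall>k\<in>{..<s}. mnorm ?N (z k - restrict_coords F (z k)) < \<delta>"
    by (rule eventually_ball_finite) (use z \<delta> ell2_restrict_coords_approx in auto)
  then obtain F where F: "finite F" "F \<subseteq> J" "\<forall>k\<in>{..<s}. mnorm ?N (z k - restrict_coords F (z k)) < \<delta>"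
    unfolding eventually_finite_subsets_at_top by auto
  let ?L = "{x :: 'j \<Rightarrow> 'a. \<forall>j. j \<notin> F \<longrightarrow> x j = 0}"
  have "module_dist ?N x ?L < \<epsilon>" if x: "x \<in> Z" for x
  proof -
    obtain a where a: "\<forall>k<s. norm (a k) \<le> M"
        "mnorm ?N (x - (\<Sum>k<s. mact ?N (z k) (a k))) < \<epsilon> / 2"
      using approx x by blast
    define y where "y = (\<Sum>k<s. mact ?N (restrict_coords F (z k)) (a k))"
    let ?w = "\<Sum>k<s. mact ?N (z k) (a k)" and ?d = "\<lambda>k. mact ?N (z k - restrict_coords F (z k)) (a k)"
    have dz: "z k - restrict_coords F (z k) \<in> mcarrier ?N" if "k < s" for k
      using z F that by (intro ell2_diff_mem ell2_restrict_coords_mem) auto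
    have d: "?d k \<in> mcarrier ?N" if "k < s" for k
      using dz[OF that] by (rule ell2_act_mem)
    have "?w - y = (\<Sum>k<s. ?d k)"
      unfolding y_def sum_subtractf[symmetric]
      by (rule sum.cong) (auto simp: mact_ell2 fun_eq_iff left_diff_distrib)
    then have eq: "x - y = (x - ?w) + (\<Sum>k<s. ?d k)" by (simp add: algebra_simps)
    have "mnorm ?N (\<Sum>k<s. ?d k) \<le> (\<Sum>k<s. mnorm ?N (?d k))"
      using d by (intro ell2_mnorm_sum) auto
    also have "\<dots> \<le> (\<Sum>k<s. \<delta> * M)"
    proof (rule sum_mono)
      fix k assume "k \<in> {..<s}"
      then have k: "k < s" by simp
      have "mnorm ?N (?d k) \<le> mnorm ?N (z k - restrict_coords F (z k)) * norm (a k)"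
        by (rule ell2_mnorm_act[OF dz[OF k]])
      also have "\<dots> \<le> \<delta> * M"
        by (rule mult_mono) (use F(3) k a(1) \<delta> in \<open>auto intro: less_imp_le\<close>)
      finally show "mnorm ?N (?d k) \<le> \<delta> * M" .
    qed
    also have "\<dots> \<le> \<epsilon> / 2" using \<delta>(2) by (simp add: algebra_simps)
    finally have small: "mnorm ?N (\<Sum>k<s. ?d k) \<le> \<epsilon> / 2" .
    have "x - ?w \<in> mcarrier ?N" using x Z z by (intro ell2_diff_mem ell2_sum_mem ell2_act_mem) auto
    then have "mnorm ?N (x - y) \<le> mnorm ?N (x - ?w) + mnorm ?N (\<Sum>k<s. ?d k)"
      unfolding eq using d by (intro ell2_mnorm_triangle ell2_sum_mem) auto
    also have "\<dots> < \<epsilon>" using a(2) small by linarith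
    finally have "mnorm ?N (x - y) < \<epsilon>" .
    moreover have "y \<in> ?L"
      by (auto simp: y_def sum_fun_apply mact_ell2 restrict_coords_def)
    moreover have "bdd_below ((\<lambda>y. mnorm ?N (x - y)) ` ?L)"
      by (rule bdd_belowI[of _ 0]) (auto simp: mnorm_def)
    ultimately show ?thesis
      unfolding module_dist_def by (meson cINF_lower le_less_trans)
  qed
  then show ?thesis using ell2_coordinate_submodule_free[OF F(1,2)] by blast
qed

theorem theorem5p1:
  shows "(\<forall>(N :: ('a::unital_cstar_algebra, 'n::ab_group_add) inner_module) Z.
            hilbert_module N \<longrightarrow> Z \<subseteq> mcarrier N \<longrightarrow> mbounded N Z \<longrightarrow>
            (\<forall>\<epsilon>>0. \<exists>L. free_fg_submodule N L \<and> (\<forall>x\<in>Z. module_dist N x L < \<epsilon>)) \<longrightarrow>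
            A_precompact N Z)
       \<and> (\<forall>(J :: 'j set) (N :: ('a, 'j \<Rightarrow> 'a) inner_module) Z.
            N = ell2 J \<longrightarrow> Z \<subseteq> mcarrier N \<longrightarrow> mbounded N Z \<longrightarrow> A_precompact N Z \<longrightarrow>
            (\<forall>\<epsilon>>0. \<exists>L. free_fg_submodule N L \<and> (\<forall>x\<in>Z. module_dist N x L < \<epsilon>)))"
  using A_precompact_if_near_free near_free_if_A_precompact_ell2 by blast

end
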